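(* A formula $\phi$ is a theorem of $\mathbf{MP}^*$ if and only if $\phi$ is GMA-valid.
   Context: Formulas: built from a countable set $\mathsf{A}$ of atomic formulas (containing $\top,\bot$) by $\land,\neg,\Box,\mathsf{K}$; $\Diamond\phi:=\neg\Box\neg\phi$, $\mathsf{L}\phi:=\neg\mathsf{K}\neg\phi$. The system $\mathbf{MP}^*$ has rules modus ponens, $\mathsf{K}$-necessitation, $\Box$-necessitation and axioms all instances of: (1) propositional tautologies; (2) $(A\to\Box A)\land(\neg A\to\Box\neg A)$ for atomic $A$; (3) $\Box(\phi\to\psi)\to(\Box\phi\to\Box\psi)$; (4) $\Box\phi\to\phi$; (5) $\Box\phi\to\Box\Box\phi$; (6) $\mathsf{K}(\phi\to\psi)\to(\mathsf{K}\phi\to\mathsf{K}\psi)$; (7) $\mathsf{K}\phi\to\phi$; (8) $\mathsf{K}\phi\to\mathsf{K}\mathsf{K}\phi$; (9) $\phi\to\mathsf{K}\mathsf{L}\phi$; (10) $\mathsf{K}\Box\phi\to\Box\mathsf{K}\phi$; (11) $\Diamond\Box\phi\to\Box\Diamond\phi$; (12) $\Diamond(\mathsf{K}\phi\land\psi)\land\mathsf{L}\Diamond(\mathsf{K}\phi\land\chi)\to\Diamond(\mathsf{K}\Diamond\phi\land\Diamond\psi\land\mathsf{L}\Diamond\chi)$. On a Boolean algebra $\langle B,\mathbf{0},\mathbf{1},-,\cap,\cup\rangle$: an interior operator $I$ satisfies $I(a\cap b)=Ia\cap Ib$, $Ia\le a$, $IIa=Ia$, $I\mathbf{1}=\mathbf{1}$,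 with dual $C=-I-$; a universal quantifier $\forall$ satisfies $\forall(a\cup\forall b)=\forall a\cup\forall b$, $\forall a\le a$, $\forall\mathbf{1}=\mathbf{1}$, with dual $\exists=-\forall-$. $B^I=\{a:a\le Ia\}\cap\{a:Ca\le a\}$. A fixed monadic algebra (FMA) is a Boolean algebra with an interior operator $I$ and universal quantifier $\forall$ with $\forall Ia\ge I\forall a$ for all $a$. A generated monadic algebra (GMA) is an FMA satisfying additionally, for all $a,b,c$: $CIa=ICa$ and $C(\forall a\cap b)\cap\exists C(\forall a\cap c)\le C(\forall Ca\cap Cb\cap\exists Cc)$. A valuation on a GMA is a map $v$ from formulas to $B$ with $v(A)\in B^I$ for atomic $A$, $v(\neg\phi)=-v(\phi)$, $v(\phi\land\psi)=v(\phi)\cap v(\psi)$, $v(\phi\lor\psi)=v(\phi)\cup v(\psi)$, $v(\Box\phi)=Iv(\phi)$, $v(\mathsf{K}\phi)=\forall v(\phi)$. A formula is GMA-valid if $v(\phi)=\mathbf{1}$ for every valuation on every GMA.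
   Formalization: The FMA condition is corrected to ∀Ia ≤ I∀a (as printed, ∀Ia ≥ I∀a, axiom (10) fails in some GMAs); valuations send ⊤, ⊥ to 1, 0; validity ranges over all GMAs whose carrier lies in an arbitrary fixed infinite type, which covers every GMA up to isomorphism. *)

theory Defs
  imports Main "HOL-Library.Countable"
begin

section \<open>Formulas\<close>

text \<open>The countable set of atomic formulas is the universe of a type of the following class, with
  two designated distinct elements for \<open>\<top>\<close> and \<open>\<bottom>\<close>. It may be finite or infinite.\<close>

class atomic_formulas = countable +
  fixes verum :: 'a
    and falsum :: 'a
  assumes verum_neq_falsum: "verum \<noteq> falsum"

instantiation nat :: atomic_formulas
begin
definition verum_nat :: nat where "verum_nat = 0"
definition falsum_nat :: nat where "falsum_nat = 1"
instance by standard (simp add: verum_nat_def falsum_nat_def)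
end

datatype 'a fm =
    Atom 'a
  | Conj "'a fm" "'a fm"
  | Neg "'a fm"
  | Box "'a fm"
  | Know "'a fm"

abbreviation Disj :: "'a fm \<Rightarrow> 'a fm \<Rightarrow> 'a fm" where
  "Disj \<phi> \<psi> \<equiv> Neg (Conj (Neg \<phi>) (Neg \<psi>))"

abbreviation Imp :: "'a fm \<Rightarrow> 'a fm \<Rightarrow> 'a fm" where
  "Imp \<phi> \<psi> \<equiv> Neg (Conj \<phi> (Neg \<psi>))"

abbreviation Dia :: "'a fm \<Rightarrow> 'a fm" where
  "Dia \<phi> \<equiv> Neg (Box (Neg \<phi>))"

abbreviation Poss :: "'a fm \<Rightarrow> 'a fm" where
  "Poss \<phi> \<equiv> Neg (Know (Neg \<phi>))"


section \<open>The system MP*\<close>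

text \<open>Formulas with outermost symbol \<open>\<box>\<close> or \<open>K\<close>, like atoms, receive arbitrary truth values;
  \<open>\<top>\<close> and \<open>\<bottom>\<close> have their usual ones. So a tautology here is a substitution instance of a
  classical propositional tautology.\<close>

primrec truth :: "('a::atomic_formulas fm \<Rightarrow> bool) \<Rightarrow> 'a fm \<Rightarrow> bool" where
  "truth g (Atom a) = (if a = verum then True else if a = falsum then False else g (Atom a))"
| "truth g (Conj \<phi> \<psi>) = (truth g \<phi> \<and> truth g \<psi>)"
| "truth g (Neg \<phi>) = (\<not> truth g \<phi>)"
| "truth g (Box \<phi>) = g (Box \<phi>)"
| "truth g (Know \<phi>) = g (Know \<phi>)"

definition tautology :: "'a::atomic_formulas fm \<Rightarrow> bool" where
  "tautology \<phi> \<longleftrightarrow> (\<forall>g. truth g \<phi>)"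

inductive MP_star :: "'a::atomic_formulas fm \<Rightarrow> bool" where
  Taut: "tautology \<phi> \<Longrightarrow> MP_star \<phi>"
| Persist: "MP_star (Conj (Imp (Atom A) (Box (Atom A))) (Imp (Neg (Atom A)) (Box (Neg (Atom A)))))"
| Box_K: "MP_star (Imp (Box (Imp \<phi> \<psi>)) (Imp (Box \<phi>) (Box \<psi>)))"
| Box_T: "MP_star (Imp (Box \<phi>) \<phi>)"
| Box_4: "MP_star (Imp (Box \<phi>) (Box (Box \<phi>)))"
| Know_K: "MP_star (Imp (Know (Imp \<phi> \<psi>)) (Imp (Know \<phi>) (Know \<psi>)))"
| Know_T: "MP_star (Imp (Know \<phi>) \<phi>)"
| Know_4: "MP_star (Imp (Know \<phi>) (Know (Know \<phi>)))"
| Know_B: "MP_star (Imp \<phi> (Know (Poss \<phi>)))"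
| Cross: "MP_star (Imp (Know (Box \<phi>)) (Box (Know \<phi>)))"
| Directed: "MP_star (Imp (Dia (Box \<phi>)) (Box (Dia \<phi>)))"
| Union: "MP_star (Imp (Conj (Dia (Conj (Know \<phi>) \<psi>)) (Poss (Dia (Conj (Know \<phi>) \<chi>))))
                       (Dia (Conj (Conj (Know (Dia \<phi>)) (Dia \<psi>)) (Poss (Dia \<chi>)))))"
| MP: "MP_star (Imp \<phi> \<psi>) \<Longrightarrow> MP_star \<phi> \<Longrightarrow> MP_star \<psi>"
| Know_nec: "MP_star \<phi> \<Longrightarrow> MP_star (Know \<phi>)"
| Box_nec: "MP_star \<phi> \<Longrightarrow> MP_star (Box \<phi>)"


section \<open>Generated monadic algebras\<close>

text \<open>Algebras have an explicit carrier, so that one type of elements accommodates algebras of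
  different sizes.\<close>

record 'b monadic_alg =
  carrier :: "'b set"
  bzero :: 'b  (\<open>\<zero>\<index>\<close>)
  bone :: 'b  (\<open>\<one>\<index>\<close>)
  compl :: "'b \<Rightarrow> 'b"  (\<open>\<sim>\<index> _\<close> [90] 90)
  meet :: "'b \<Rightarrow> 'b \<Rightarrow> 'b"  (infixl \<open>\<sqinter>\<index>\<close> 70)
  join :: "'b \<Rightarrow> 'b \<Rightarrow> 'b"  (infixl \<open>\<squnion>\<index>\<close> 65)
  interior :: "'b \<Rightarrow> 'b"  (\<open>\<^bold>I\<index> _\<close> [90] 90)
  univ :: "'b \<Rightarrow> 'b"  (\<open>\<^bold>\<forall>\<index> _\<close> [90] 90)

definition le :: "('b, 'm) monadic_alg_scheme \<Rightarrow> 'b \<Rightarrow> 'b \<Rightarrow> bool"  (infix \<open>\<sqsubseteq>\<index>\<close> 50) where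
  "le M a b \<longleftrightarrow> a \<sqinter>\<^bsub>M\<^esub> b = a"

definition closure :: "('b, 'm) monadic_alg_scheme \<Rightarrow> 'b \<Rightarrow> 'b"  (\<open>\<^bold>C\<index> _\<close> [90] 90) where
  "closure M a = \<sim>\<^bsub>M\<^esub> (\<^bold>I\<^bsub>M\<^esub> (\<sim>\<^bsub>M\<^esub> a))"

definition exis :: "('b, 'm) monadic_alg_scheme \<Rightarrow> 'b \<Rightarrow> 'b"  (\<open>\<^bold>\<exists>\<index> _\<close> [90] 90) where
  "exis M a = \<sim>\<^bsub>M\<^esub> (\<^bold>\<forall>\<^bsub>M\<^esub> (\<sim>\<^bsub>M\<^esub> a))"

locale boolean_alg =
  fixes M :: "('b, 'm) monadic_alg_scheme" (structure)
  assumes zero_closed: "\<zero> \<in> carrier M"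
    and one_closed: "\<one> \<in> carrier M"
    and compl_closed: "a \<in> carrier M \<Longrightarrow> \<sim> a \<in> carrier M"
    and meet_closed: "\<lbrakk>a \<in> carrier M; b \<in> carrier M\<rbrakk> \<Longrightarrow> a \<sqinter> b \<in> carrier M"
    and join_closed: "\<lbrakk>a \<in> carrier M; b \<in> carrier M\<rbrakk> \<Longrightarrow> a \<squnion> b \<in> carrier M"
    and meet_assoc: "\<lbrakk>a \<in> carrier M; b \<in> carrier M; c \<in> carrier M\<rbrakk>
                       \<Longrightarrow> (a \<sqinter> b) \<sqinter> c = a \<sqinter> (b \<sqinter> c)"
    and join_assoc: "\<lbrakk>a \<in> carrier M; b \<in> carrier M; c \<in> carrier M\<rbrakk>
                       \<Longrightarrow> (a \<squnion> b) \<squnion> c = a \<squnion> (b \<squnion> c)"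
    and meet_comm: "\<lbrakk>a \<in> carrier M; b \<in> carrier M\<rbrakk> \<Longrightarrow> a \<sqinter> b = b \<sqinter> a"
    and join_comm: "\<lbrakk>a \<in> carrier M; b \<in> carrier M\<rbrakk> \<Longrightarrow> a \<squnion> b = b \<squnion> a"
    and meet_join_distrib: "\<lbrakk>a \<in> carrier M; b \<in> carrier M; c \<in> carrier M\<rbrakk>
                       \<Longrightarrow> a \<sqinter> (b \<squnion> c) = (a \<sqinter> b) \<squnion> (a \<sqinter> c)"
    and join_meet_distrib: "\<lbrakk>a \<in> carrier M; b \<in> carrier M; c \<in> carrier M\<rbrakk>
                       \<Longrightarrow> a \<squnion> (b \<sqinter> c) = (a \<squnion> b) \<sqinter> (a \<squnion> c)"
    and meet_one: "a \<in> carrier M \<Longrightarrow> a \<sqinter> \<one> = a"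
    and join_zero: "a \<in> carrier M \<Longrightarrow> a \<squnion> \<zero> = a"
    and meet_compl: "a \<in> carrier M \<Longrightarrow> a \<sqinter> \<sim> a = \<zero>"
    and join_compl: "a \<in> carrier M \<Longrightarrow> a \<squnion> \<sim> a = \<one>"

locale interior_operator = boolean_alg +
  assumes interior_closed: "a \<in> carrier M \<Longrightarrow> \<^bold>I a \<in> carrier M"
    and interior_meet: "\<lbrakk>a \<in> carrier M; b \<in> carrier M\<rbrakk> \<Longrightarrow> \<^bold>I (a \<sqinter> b) = \<^bold>I a \<sqinter> \<^bold>I b"
    and interior_le: "a \<in> carrier M \<Longrightarrow> \<^bold>I a \<sqsubseteq> a"
    and interior_idem: "a \<in> carrier M \<Longrightarrow> \<^bold>I (\<^bold>I a) = \<^bold>I a"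
    and interior_one: "\<^bold>I \<one> = \<one>"

locale universal_quantifier = boolean_alg +
  assumes univ_closed: "a \<in> carrier M \<Longrightarrow> \<^bold>\<forall> a \<in> carrier M"
    and univ_join: "\<lbrakk>a \<in> carrier M; b \<in> carrier M\<rbrakk> \<Longrightarrow> \<^bold>\<forall> (a \<squnion> \<^bold>\<forall> b) = \<^bold>\<forall> a \<squnion> \<^bold>\<forall> b"
    and univ_le: "a \<in> carrier M \<Longrightarrow> \<^bold>\<forall> a \<sqsubseteq> a"
    and univ_one: "\<^bold>\<forall> \<one> = \<one>"

text \<open>The inequality between \<open>\<forall>I\<close> and \<open>I\<forall>\<close> is the algebraic form of \<open>K\<box>\<phi> \<rightarrow> \<box>K\<phi>\<close>. Its reverse
  \<open>I\<forall>a \<le> \<forall>Ia\<close> would not make that axiom valid: take the subsets of \<open>{x, y, z}\<close>, with \<open>I\<close> induced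
  by the preorder whose only nontrivial step is from \<open>x\<close> to \<open>y\<close>, \<open>\<forall>\<close> induced by the partition
  \<open>{x}\<close>, \<open>{y, z}\<close>, and an atom with value \<open>{x, y}\<close>.\<close>

locale FMA = interior_operator + universal_quantifier +
  assumes univ_interior_le: "a \<in> carrier M \<Longrightarrow> \<^bold>\<forall> (\<^bold>I a) \<sqsubseteq> \<^bold>I (\<^bold>\<forall> a)"

locale GMA = FMA +
  assumes closure_interior: "a \<in> carrier M \<Longrightarrow> \<^bold>C (\<^bold>I a) = \<^bold>I (\<^bold>C a)"
    and union_le: "\<lbrakk>a \<in> carrier M; b \<in> carrier M; c \<in> carrier M\<rbrakk> \<Longrightarrow>
          \<^bold>C (\<^bold>\<forall> a \<sqinter> b) \<sqinter> \<^bold>\<exists> (\<^bold>C (\<^bold>\<forall> a \<sqinter> c))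
            \<sqsubseteq> \<^bold>C (\<^bold>\<forall> (\<^bold>C a) \<sqinter> \<^bold>C b \<sqinter> \<^bold>\<exists> (\<^bold>C c))"

definition stable :: "('b, 'm) monadic_alg_scheme \<Rightarrow> 'b set" where
  "stable M = {a \<in> carrier M. a \<sqsubseteq>\<^bsub>M\<^esub> \<^bold>I\<^bsub>M\<^esub> a} \<inter> {a \<in> carrier M. \<^bold>C\<^bsub>M\<^esub> a \<sqsubseteq>\<^bsub>M\<^esub> a}"

text \<open>The atoms \<open>\<top>\<close> and \<open>\<bottom>\<close> are logical constants, hence the first two clauses after the range.\<close>

locale valuation =
  fixes M :: "('b, 'm) monadic_alg_scheme" (structure)
    and v :: "'a::atomic_formulas fm \<Rightarrow> 'b"
  assumes v_range: "v \<phi> \<in> carrier M"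
    and v_verum: "v (Atom verum) = \<one>"
    and v_falsum: "v (Atom falsum) = \<zero>"
    and v_Atom: "v (Atom A) \<in> stable M"
    and v_Neg: "v (Neg \<phi>) = \<sim> (v \<phi>)"
    and v_Conj: "v (Conj \<phi> \<psi>) = v \<phi> \<sqinter> v \<psi>"
    and v_Disj: "v (Disj \<phi> \<psi>) = v \<phi> \<squnion> v \<psi>"
    and v_Box: "v (Box \<phi>) = \<^bold>I (v \<phi>)"
    and v_Know: "v (Know \<phi>) = \<^bold>\<forall> (v \<phi>)"

text \<open>Validity in all algebras whose carrier is a set of elements of the given type.\<close>

definition GMA_valid :: "'b itself \<Rightarrow> 'a::atomic_formulas fm \<Rightarrow> bool" where
  "GMA_valid (_ :: 'b itself) \<phi> \<longleftrightarrow>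
     (\<forall>(M :: 'b monadic_alg) v. GMA M \<and> valuation M v \<longrightarrow> v \<phi> = \<one>\<^bsub>M\<^esub>)"

end

theory Submission imports Defs begin

text \<open>Soundness is checked pointwise on two-valued homomorphisms, which separate the elements of a
  Boolean algebra. Completeness uses the Lindenbaum algebra. The only GMA law that is not an axiom
  of \<open>MP*\<close> in disguise is \<open>ICa \<le> CIa\<close>. It holds because the algebra is generated by stable elements
  (\<open>Ia = a = Ca\<close>): by the union axiom, the finite joins of elements \<open>s \<inter> \<forall>p \<inter> \<exists>q\<^sub>1 \<inter> \<dots> \<inter> \<exists>q\<^sub>n\<close> with
  \<open>s, p, q\<^sub>1, \<dots>, q\<^sub>n\<close> stable are closed under all operations, and \<open>CIa \<union> CI(-a) = 1\<close>, which is preserved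
  by Boolean operations, holds for \<open>a\<close> stable and for \<open>a = \<forall>p\<close> with \<open>p\<close> stable.
  The Lindenbaum algebra is countable, so it has a copy inside every infinite type.\<close>

section \<open>Algebras generated by stable elements\<close>

text \<open>Contraposition relative to \<open>a\<close>; it turns monotonicity facts about
  \<open>I\<close> and \<open>K\<close> into facts about their duals.\<close>

lemma inf_compl_swap: "inf a b \<le> c \<Longrightarrow> inf a (- c) \<le> - b" for a b c :: "'b::boolean_algebra"
  by (simp add: shunt1 sup_commute)

text \<open>The modal axioms of \<open>MP_star\<close> read algebraically, with diamonds written out
  so that they lift literally. Of the equation between \<open>C (I a)\<close> and
  \<open>I (C a)\<close> only the half \<open>directed\<close> is assumed; the other is derived
  below for generated elements.\<close>

locale weak_GMA =
  fixes I K :: "'b::boolean_algebra \<Rightarrow> 'b"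
  assumes I_inf: "I (inf a b) = inf (I a) (I b)"
    and I_le: "I a \<le> a"
    and I_idem: "I (I a) = I a"
    and I_top: "I top = top"
    and K_inf: "K (inf a b) = inf (K a) (K b)"
    and K_le: "K a \<le> a"
    and K_idem: "K (K a) = K a"
    and K_B: "a \<le> K (- K (- a))"
    and K_top: "K top = top"
    and cross: "K (I a) \<le> I (K a)"
    and directed: "- I (- I a) \<le> I (- I (- a))"
    and union: "inf (- I (- inf (K a) b)) (- K (- (- I (- inf (K a) c))))
      \<le> - I (- inf (inf (K (- I (- a))) (- I (- b))) (- K (- (- I (- c)))))"
begin

section \<open>Elementary laws of the operators and their duals\<close>

definition C :: "'b \<Rightarrow> 'b" where "C a = - I (- a)"
definition L :: "'b \<Rightarrow> 'b" where "L a = - K (- a)"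

lemma I_mono: "a \<le> b \<Longrightarrow> I a \<le> I b"
  by (metis I_inf inf.orderE inf_le2)

lemma K_mono: "a \<le> b \<Longrightarrow> K a \<le> K b"
  by (metis K_inf inf.orderE inf_le2)

lemma C_mono: "a \<le> b \<Longrightarrow> C a \<le> C b"
  by (simp add: C_def I_mono)

lemma L_mono: "a \<le> b \<Longrightarrow> L a \<le> L b"
  by (simp add: L_def K_mono)

lemma C_ge: "a \<le> C a"
  by (metis C_def I_le compl_le_swap1)

lemma L_ge: "a \<le> L a"
  by (metis L_def K_le compl_le_swap1)

lemma C_idem: "C (C a) = C a"
  by (simp add: C_def I_idem)

lemma C_sup: "C (sup a b) = sup (C a) (C b)"
  by (simp add: C_def I_inf)

lemma L_sup: "L (sup a b) = sup (L a) (L b)"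
  by (simp add: L_def K_inf)

lemma C_bot: "C bot = bot"
  by (simp add: C_def I_top)

lemma L_bot: "L bot = bot"
  by (simp add: L_def K_top)

text \<open>\<open>K_B\<close> at \<open>- K a\<close> with \<open>K_idem\<close> gives
  \<open>- K a \<le> K (- K a)\<close>: symmetry and transitivity make \<open>K\<close> an S5
  modality.\<close>

lemma L_K: "L (K a) = K a"
  by (metis K_B K_idem K_mono L_def L_ge antisym compl_le_swap1 double_compl)

lemma K_L: "K (L a) = L a"
  by (metis L_K L_def double_compl)

lemma C_L_le: "C (L a) \<le> L (C a)"
  by (metis C_def L_def compl_le_swap1 cross double_compl)

lemma CI_le_IC: "C (I a) \<le> I (C a)"
  using directed by (simp add: C_def)

text \<open>The topological fact that a point of an open set lying in the closure of
  \<open>b\<close> is approached by points of \<open>b\<close> inside that open set.\<close>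

lemma inf_I_C_le: "inf (I a) (C b) \<le> C (inf (I a) b)"
proof -
  have "inf (I a) (- inf (I a) b) \<le> - b"
    by (simp add: inf_sup_distrib1)
  from I_mono [OF this] have "inf (I a) (I (- inf (I a) b)) \<le> I (- b)"
    by (simp add: I_inf I_idem)
  then have "inf (I a) (- I (- b)) \<le> - I (- inf (I a) b)"
    by (rule inf_compl_swap)
  then show ?thesis by (simp add: C_def)
qed

lemma L_inf_K: "L (inf (K a) b) = inf (K a) (L b)"
proof (rule antisym)
  show "L (inf (K a) b) \<le> inf (K a) (L b)"
    using L_mono [of "inf (K a) b" "K a"] L_mono [of "inf (K a) b" b] by (simp add: L_K)
next
  have "inf (K a) (- inf (K a) b) \<le> - b"
    by (simp add: inf_sup_distrib1)
  from K_mono [OF this] have "inf (K a) (K (- inf (K a) b)) \<le> K (- b)"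
    by (simp add: K_inf K_idem)
  then have "inf (K a) (- K (- b)) \<le> - K (- inf (K a) b)"
    by (rule inf_compl_swap)
  then show "inf (K a) (L b) \<le> L (inf (K a) b)" by (simp add: L_def)
qed

text \<open>Complemented form of \<open>L_inf_K\<close>. This is the law by which
  \<open>universal_quantifier\<close> axiomatizes quantifiers, here recovered from the S5
  laws.\<close>

lemma K_sup_K: "K (sup a (K b)) = sup (K a) (K b)"
proof -
  have "L (inf (- K b) (- a)) = inf (- K b) (L (- a))"
    using L_inf_K [of "L (- b)" "- a"] by (simp add: K_L) (simp add: L_def)
  then have "- L (inf (- K b) (- a)) = - inf (- K b) (L (- a))"
    by simp
  then show ?thesis by (simp add: L_def sup_commute)
qed

lemma union_C_L:
  "inf (C (inf (K a) b)) (L (C (inf (K a) c))) \<le> C (inf (inf (K (C a)) (C b)) (L (C c)))"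
  using union by (simp add: C_def L_def)

section \<open>Stable elements\<close>

definition S :: "'b set" where "S = {a. I a = a \<and> C a = a}"

lemma S_I: "a \<in> S \<Longrightarrow> I a = a" and S_C: "a \<in> S \<Longrightarrow> C a = a"
  by (auto simp: S_def)

lemma S_compl: "a \<in> S \<Longrightarrow> - a \<in> S"
  by (metis (mono_tags, lifting) C_def S_def double_compl mem_Collect_eq)

lemma S_inf: "a \<in> S \<Longrightarrow> b \<in> S \<Longrightarrow> inf a b \<in> S"
  using C_mono [of "inf a b" a] C_mono [of "inf a b" b] C_ge [of "inf a b"]
  by (auto simp: S_def I_inf intro: antisym)

lemma S_top: "top \<in> S"
  by (simp add: S_def I_top C_ge top_le)

text \<open>Closedness of \<open>s\<close> bounds the left side by \<open>s\<close>; openness of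
  \<open>s\<close> lets \<open>inf_I_C_le\<close> give the converse.\<close>

lemma C_inf_S: "s \<in> S \<Longrightarrow> C (inf s a) = inf s (C a)"
  using C_mono [of "inf s a" s] C_mono [of "inf s a" a] inf_I_C_le [of s a]
  by (intro antisym) (auto simp: S_C S_I)

lemma I_K_S: "p \<in> S \<Longrightarrow> I (K p) = K p"
  using cross [of p] by (intro antisym I_le) (simp add: S_I)

text \<open>\<open>K p\<close> is open by \<open>cross\<close>, so \<open>directed\<close> makes its
  closure open as well. Thus closing \<open>K p\<close> leads back to the generators.\<close>

lemma C_K_S:
  assumes "p \<in> S"
  shows "C (K p) \<in> S"
proof -
  have "C (K p) \<le> I (C (K p))"
    using CI_le_IC [of "K p"] I_K_S [OF assms] by simp
  then show ?thesis
    by (simp add: S_def C_idem I_le antisym)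
qed

section \<open>Normal forms and their closure under the operations\<close>

inductive_set G :: "'b set" where
  G_top: "top \<in> G"
| G_L: "b \<in> G \<Longrightarrow> q \<in> S \<Longrightarrow> inf b (L q) \<in> G"

lemma G_inf: "c \<in> G \<Longrightarrow> b \<in> G \<Longrightarrow> inf b c \<in> G"
  by (induction rule: G.induct) (auto simp: G_L inf_assoc [symmetric])

lemma G_K: "b \<in> G \<Longrightarrow> K b = b"
  by (induction rule: G.induct) (auto simp: K_top K_inf K_L)

text \<open>Each factor \<open>L q\<close> is closed by \<open>C_L_le\<close>, the dual of
  \<open>cross\<close>, and meets of closed elements are closed.\<close>

lemma G_C_le: "b \<in> G \<Longrightarrow> C b \<le> b"
proof (induction rule: G.induct)
  case (G_L b q)
  have "C (L q) \<le> L q" using C_L_le [of q] S_C [OF G_L(2)] by simp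
  then show ?case
    using G_L C_mono [of "inf b (L q)" b] C_mono [of "inf b (L q)" "L q"]
    by (auto intro: order_trans)
qed simp

text \<open>Joins of elements \<open>s \<inter> Kp \<inter> b\<close>, where \<open>b\<close> is a meet of elements \<open>Lq\<close>.\<close>

inductive_set D :: "'b set" where
  D_bot: "bot \<in> D"
| D_sup: "s \<in> S \<Longrightarrow> p \<in> S \<Longrightarrow> b \<in> G \<Longrightarrow> d \<in> D \<Longrightarrow> sup (inf (inf s (K p)) b) d \<in> D"

lemma D_prime: "s \<in> S \<Longrightarrow> p \<in> S \<Longrightarrow> b \<in> G \<Longrightarrow> inf (inf s (K p)) b \<in> D"
  using D_sup [OF _ _ _ D_bot] by simp

lemma D_join: "c \<in> D \<Longrightarrow> d \<in> D \<Longrightarrow> sup c d \<in> D"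
  by (induction c rule: D.induct) (auto simp: D_sup sup_assoc)

text \<open>Two single normal forms merge factor by factor, the \<open>K\<close> parts through
  \<open>K_inf\<close>; distributivity does the rest.\<close>

lemma D_prime_inf:
  assumes "s \<in> S" "p \<in> S" "b \<in> G" "d \<in> D"
  shows "inf (inf (inf s (K p)) b) d \<in> D"
  using assms(4)
proof (induction rule: D.induct)
  case (D_sup s' p' b' d)
  have "inf (inf (inf s (K p)) b) (inf (inf s' (K p')) b') = inf (inf (inf s s') (K (inf p p'))) (inf b b')"
    by (simp add: K_inf ac_simps)
  also have "\<dots> \<in> D"
    using assms D_sup by (intro D_prime S_inf G_inf)
  finally show ?case
    using D_sup by (simp add: inf_sup_distrib1 D_join)
qed (simp add: D_bot)

lemma D_inf: "c \<in> D \<Longrightarrow> d \<in> D \<Longrightarrow> inf c d \<in> D"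
  by (induction c rule: D.induct) (auto simp: D_bot inf_sup_distrib2 D_join D_prime_inf)

lemma D_S: "s \<in> S \<Longrightarrow> s \<in> D"
  using D_prime [of s top top] by (simp add: S_top G_top K_top)

lemma D_K: "p \<in> S \<Longrightarrow> K p \<in> D"
  using D_prime [of top p top] by (simp add: S_top G_top)

lemma D_G: "b \<in> G \<Longrightarrow> b \<in> D"
  using D_prime [of top top b] by (simp add: S_top K_top)

lemma D_L: "q \<in> S \<Longrightarrow> L q \<in> D"
  using D_G [OF G_L [OF G_top]] by simp

lemma D_compl_G: "b \<in> G \<Longrightarrow> - b \<in> D"
proof (induction rule: G.induct)
  case (G_L b q)
  have "- L q \<in> D" using D_K [OF S_compl [OF G_L(2)]] by (simp add: L_def)
  then show ?case using G_L by (simp add: D_join)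
qed (simp add: D_bot)

text \<open>By De Morgan it suffices to complement the factors: \<open>- s\<close> is stable,
  \<open>- K p\<close> is \<open>L (- p)\<close>, and \<open>- b\<close> is a join of elements
  \<open>K (- q)\<close>.\<close>

lemma D_compl: "d \<in> D \<Longrightarrow> - d \<in> D"
proof (induction rule: D.induct)
  case D_bot
  show ?case using D_S [OF S_top] by simp
next
  case (D_sup s p b d)
  have "- K p \<in> D" using D_L [OF S_compl [OF D_sup(2)]] by (simp add: L_def)
  then show ?case using D_sup by (simp add: D_inf D_join D_compl_G D_S S_compl)
qed

text \<open>Pulls the factors \<open>Lq\<close> of a normal form out of the scope of \<open>C\<close> one at a time; only here is the
  union axiom used.\<close>

lemma C_K_inf_L:
  assumes "p \<in> S" "q \<in> S" "C b \<le> b"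
  shows "C (inf (K p) (inf b (L q))) = inf (C (inf (K p) b)) (L (inf (C (K p)) q))"
proof (rule antisym)
  have q: "C (inf (K p) q) = inf (C (K p)) q"
    using C_inf_S [OF assms(2), of "K p"] by (simp add: inf_commute)
  have "C (inf (K p) (L q)) \<le> L (inf (C (K p)) q)"
    using C_L_le [of "inf (K p) q"] by (simp add: L_inf_K q)
  moreover have "C (inf (K p) (inf b (L q))) \<le> C (inf (K p) (L q))"
    by (intro C_mono inf_mono) auto
  moreover have "C (inf (K p) (inf b (L q))) \<le> C (inf (K p) b)"
    by (intro C_mono inf_mono) auto
  ultimately show "C (inf (K p) (inf b (L q))) \<le> inf (C (inf (K p) b)) (L (inf (C (K p)) q))"
    by simp
  have "inf (C (inf (K p) b)) (L (inf (C (K p)) q)) \<le> C (inf (inf (K p) (C b)) (L q))"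
    using union_C_L [of p b q] by (simp add: q S_C assms)
  also have "\<dots> \<le> C (inf (K p) (inf b (L q)))"
    unfolding inf_assoc using assms(3) by (intro C_mono inf_mono) auto
  finally show "inf (C (inf (K p) b)) (L (inf (C (K p)) q)) \<le> C (inf (K p) (inf b (L q)))" .
qed

text \<open>Induction strips the factors \<open>L q\<close> one by one with
  \<open>C_K_inf_L\<close>, leaving \<open>C (K p)\<close>, stable by \<open>C_K_S\<close>. Each new
  factor is \<open>L\<close> of a stable element.\<close>

lemma D_C_K_G: "b \<in> G \<Longrightarrow> p \<in> S \<Longrightarrow> C (inf (K p) b) \<in> D"
  by (induction rule: G.induct)
    (auto simp: D_S C_K_S C_K_inf_L G_C_le intro!: D_inf D_L S_inf)

lemma D_C: "d \<in> D \<Longrightarrow> C d \<in> D"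
  by (induction rule: D.induct)
    (simp_all add: C_bot D_bot C_sup inf_assoc C_inf_S D_C_K_G D_join D_inf D_S)

text \<open>Both \<open>K p\<close> and \<open>b\<close> are fixed by \<open>K\<close>, so their
  meet is \<open>K (inf p b)\<close> and \<open>L_inf_K\<close> leaves only \<open>s\<close> under
  \<open>L\<close>.\<close>

lemma L_prime: "b \<in> G \<Longrightarrow> L (inf (inf s (K p)) b) = inf (inf (L s) (K p)) b"
  using L_inf_K [of "inf p b" s] by (simp add: K_inf G_K ac_simps)

lemma D_L_closed: "d \<in> D \<Longrightarrow> L d \<in> D"
  by (induction rule: D.induct)
    (simp_all add: L_bot D_bot L_sup L_prime D_join D_inf D_L D_K D_G)

lemma D_I: "d \<in> D \<Longrightarrow> I d \<in> D"
  using D_C D_compl unfolding C_def by (metis double_compl)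

lemma D_K_closed: "d \<in> D \<Longrightarrow> K d \<in> D"
  using D_L_closed D_compl unfolding L_def by (metis double_compl)

text \<open>Since \<open>- C (I (- a))\<close> is \<open>I (C a)\<close>, this expresses the missing
  inequality \<open>I (C a) \<le> C (I a)\<close> in a form symmetric in \<open>a\<close> and
  \<open>- a\<close>, which suits induction over Boolean operations.\<close>

definition decided :: "'b \<Rightarrow> bool" where "decided a \<longleftrightarrow> sup (C (I a)) (C (I (- a))) = top"

text \<open>\<open>directed\<close> puts \<open>C (I a)\<close> below an open element, so
  \<open>inf_I_C_le\<close> applies twice: first with that open element, then with
  \<open>I b\<close>.\<close>

lemma CI_inf: "inf (C (I a)) (C (I b)) \<le> C (I (inf a b))"
proof -
  have "inf (C (I a)) (C (I b)) \<le> inf (I (C (I a))) (C (I b))"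
    using CI_le_IC [of "I a"] by (simp add: I_idem le_infI1)
  also have "\<dots> \<le> C (inf (I (C (I a))) (I b))"
    by (rule inf_I_C_le)
  also have "\<dots> \<le> C (inf (I b) (C (I a)))"
    by (intro C_mono) (simp add: I_le le_infI1)
  also have "\<dots> \<le> C (C (inf (I b) (I a)))"
    by (intro C_mono inf_I_C_le)
  finally show ?thesis by (simp add: C_idem I_inf inf_commute)
qed

lemma CI_mono: "a \<le> b \<Longrightarrow> C (I a) \<le> C (I b)"
  by (intro C_mono I_mono)

lemma decided_compl: "decided a \<Longrightarrow> decided (- a)"
  by (simp add: decided_def sup_commute)

lemma decided_inf:
  assumes "decided a" "decided b"
  shows "decided (inf a b)"
proof -
  let ?x = "sup (C (I (inf a b))) (C (I (- inf a b)))"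
  \<comment> \<open>Of the four meets obtained by distributing, three lie below
    \<open>C (I (- a))\<close> or \<open>C (I (- b))\<close>; the fourth needs
    \<open>CI_inf\<close>.\<close>
  have "C (I (- a)) \<le> ?x" "C (I (- b)) \<le> ?x"
    by (simp_all add: le_supI2 CI_mono)
  moreover have "inf (C (I a)) (C (I b)) \<le> ?x"
    by (rule le_supI1 [OF CI_inf])
  ultimately have "inf (sup (C (I a)) (C (I (- a)))) (sup (C (I b)) (C (I (- b)))) \<le> ?x"
    by (simp add: inf_sup_distrib1 inf_sup_distrib2 le_infI1 le_infI2)
  then show ?thesis using assms by (simp add: decided_def top_le)
qed

lemma decided_sup: "decided a \<Longrightarrow> decided b \<Longrightarrow> decided (sup a b)"
  using decided_compl [OF decided_inf [OF decided_compl decided_compl, of a b]] by simp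

lemma decided_S: "s \<in> S \<Longrightarrow> decided s"
  using S_compl [of s] by (simp add: decided_def S_I S_C)

text \<open>\<open>K p\<close> is open, and for open \<open>x\<close> the complement of
  \<open>C x\<close> is the open element \<open>I (- x)\<close>, which lies below its own
  closure.\<close>

lemma decided_K:
  assumes "p \<in> S"
  shows "decided (K p)"
proof -
  have "- C (K p) = I (- K p)" by (simp add: C_def)
  then have "- C (K p) \<le> C (I (- K p))" using C_ge by metis
  then show ?thesis
    by (simp add: decided_def I_K_S assms sup_shunt)
qed

lemma decided_G: "b \<in> G \<Longrightarrow> decided b"
proof (induction rule: G.induct)
  case (G_L b q)
  have "decided (L q)"
    unfolding L_def using G_L S_compl by (intro decided_compl decided_K)
  then show ?case using G_L by (simp add: decided_inf)
qed (simp add: decided_S S_top)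

lemma decided_D: "d \<in> D \<Longrightarrow> decided d"
proof (induction rule: D.induct)
  case D_bot
  show ?case using decided_compl [OF decided_S [OF S_top]] by simp
qed (simp add: decided_sup decided_inf decided_S decided_K decided_G)

lemma CI_eq_IC:
  assumes "d \<in> D"
  shows "C (I d) = I (C d)"
proof (rule antisym [OF CI_le_IC])
  have "I (C d) = - C (I (- d))" by (simp add: C_def)
  then show "I (C d) \<le> C (I d)"
    using decided_D [OF assms] by (simp add: decided_def sup_shunt compl_le_swap2)
qed

end

section \<open>Soundness\<close>

context boolean_alg
begin

lemma meet_zero: "a \<in> carrier M \<Longrightarrow> a \<sqinter> \<zero> = \<zero>"
  by (metis compl_closed join_comm join_zero meet_closed meet_compl meet_join_distrib zero_closed)

lemma meet_idem: "a \<in> carrier M \<Longrightarrow> a \<sqinter> a = a"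
  by (metis compl_closed join_compl join_zero meet_closed meet_compl meet_join_distrib meet_one)

lemma meet_le1: "a \<in> carrier M \<Longrightarrow> b \<in> carrier M \<Longrightarrow> a \<sqinter> b \<sqsubseteq> a"
  by (metis le_def meet_assoc meet_comm meet_idem)

lemma le_join1:
  assumes "a \<in> carrier M" "b \<in> carrier M"
  shows "a \<sqsubseteq> a \<squnion> b"
  using join_meet_distrib [of a \<zero> b] meet_comm [of \<zero> b] assms
  by (simp add: le_def join_zero meet_zero zero_closed)

lemma le_refl: "a \<in> carrier M \<Longrightarrow> a \<sqsubseteq> a"
  by (simp add: le_def meet_idem)

lemma le_trans:
  "\<lbrakk>a \<sqsubseteq> b; b \<sqsubseteq> c; a \<in> carrier M; b \<in> carrier M; c \<in> carrier M\<rbrakk> \<Longrightarrow> a \<sqsubseteq> c"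
  by (metis le_def meet_assoc)

lemma le_antisym: "\<lbrakk>a \<sqsubseteq> b; b \<sqsubseteq> a; a \<in> carrier M; b \<in> carrier M\<rbrakk> \<Longrightarrow> a = b"
  by (metis le_def meet_comm)

lemma meet_swap:
  "\<lbrakk>a \<in> carrier M; b \<in> carrier M; c \<in> carrier M; d \<in> carrier M\<rbrakk>
    \<Longrightarrow> (a \<sqinter> b) \<sqinter> (c \<sqinter> d) = (a \<sqinter> c) \<sqinter> (b \<sqinter> d)"
  by (metis meet_assoc meet_closed meet_comm)

lemma meet_mono:
  "\<lbrakk>a \<sqsubseteq> c; b \<sqsubseteq> d; a \<in> carrier M; b \<in> carrier M; c \<in> carrier M; d \<in> carrier M\<rbrakk>
    \<Longrightarrow> a \<sqinter> b \<sqsubseteq> c \<sqinter> d"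
  unfolding le_def using meet_swap [of a b c d] by simp

text \<open>The empty set qualifies; nonemptiness is supplied below by an explicit member
  \<open>c\<close>.\<close>

definition proper_filter :: "'b set \<Rightarrow> bool" where
  "proper_filter F \<longleftrightarrow> F \<subseteq> carrier M \<and> \<zero> \<notin> F
    \<and> (\<forall>a\<in>F. \<forall>b\<in>F. a \<sqinter> b \<in> F) \<and> (\<forall>a\<in>F. \<forall>b\<in>carrier M. a \<sqsubseteq> b \<longrightarrow> b \<in> F)"

lemma maximal_filter_exists:
  assumes "c \<in> carrier M" "c \<noteq> \<zero>"
  obtains F where "proper_filter F" "c \<in> F" "\<And>F'. proper_filter F' \<Longrightarrow> F \<subseteq> F' \<Longrightarrow> F' = F"
proof -
  define A where "A = {F. proper_filter F \<and> c \<in> F}"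
  define U where "U = {x \<in> carrier M. c \<sqsubseteq> x}"
  have "U \<in> A"
    unfolding A_def proper_filter_def
  proof (intro CollectI conjI ballI impI)
    show "\<zero> \<notin> U"
      using assms meet_zero by (auto simp: U_def le_def)
    fix a b assume "a \<in> U" "b \<in> U"
    then show "a \<sqinter> b \<in> U"
      using meet_mono [of c a c b] assms by (auto simp: U_def meet_idem meet_closed)
  next
    fix a b assume "a \<in> U" "b \<in> carrier M" "a \<sqsubseteq> b"
    then show "b \<in> U"
      using le_trans assms unfolding U_def by blast
  qed (use assms le_refl in \<open>auto simp: U_def\<close>)
  then have ne: "A \<noteq> {}" by blast
  have "\<Union>\<C> \<in> A" if ne: "\<C> \<noteq> {}" and ch: "subset.chain A \<C>" for \<C>
  proof -
    have *: "\<And>F. F \<in> \<C> \<Longrightarrow> proper_filter F \<and> c \<in> F"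
      using ch by (auto simp: subset.chain_def A_def)
    have "a \<sqinter> b \<in> \<Union>\<C>" if ab: "a \<in> \<Union>\<C>" "b \<in> \<Union>\<C>" for a b
    proof -
      obtain X Y where XY: "X \<in> \<C>" "Y \<in> \<C>" "a \<in> X" "b \<in> Y" using ab by blast
      then have "X \<subseteq> Y \<or> Y \<subseteq> X" using ch by (auto simp: subset.chain_def)
      then show ?thesis using XY * unfolding proper_filter_def by blast
    qed
    then show ?thesis
      using * ne unfolding A_def proper_filter_def by blast
  qed
  from subset_Zorn_nonempty [OF ne this] obtain F
    where F: "F \<in> A" "\<forall>X\<in>A. F \<subseteq> X \<longrightarrow> X = F" by blast
  show ?thesis
  proof (rule that)
    \<comment> \<open>A proper filter extending \<open>F\<close> contains \<open>c\<close>, so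
      maximality among the filters with \<open>c\<close> is maximality among all.\<close>
    show "F' = F" if "proper_filter F'" "F \<subseteq> F'" for F'
      using F that by (auto simp: A_def)
  qed (use F in \<open>auto simp: A_def\<close>)
qed

text \<open>The filter generated by \<open>F\<close> and \<open>a\<close> is strictly larger than
  \<open>F\<close>, so it cannot be proper and must contain \<zero>. The member \<open>c\<close> is
  what puts \<open>a\<close> into it.\<close>

lemma maximal_filter_meet_zero:
  assumes F: "proper_filter F" "\<And>F'. proper_filter F' \<Longrightarrow> F \<subseteq> F' \<Longrightarrow> F' = F"
    and c: "c \<in> F" and a: "a \<in> carrier M" "a \<notin> F"
  obtains f where "f \<in> F" "f \<sqinter> a = \<zero>"
proof -
  have Fc: "f \<in> carrier M" if "f \<in> F" for f
    using F(1) that by (auto simp: proper_filter_def)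
  have Fm: "f \<sqinter> g \<in> F" if "f \<in> F" "g \<in> F" for f g
    using F(1) that by (auto simp: proper_filter_def)
  define F' where "F' = {x \<in> carrier M. \<exists>f\<in>F. f \<sqinter> a \<sqsubseteq> x}"
  have "F \<subseteq> F'"
    using Fc a meet_le1 by (auto simp: F'_def)
  moreover have "c \<sqinter> a \<sqsubseteq> a"
    using meet_le1 [of a c] meet_comm [of a c] c Fc a by simp
  then have "a \<in> F'"
    using c a by (auto simp: F'_def)
  ultimately have "\<not> proper_filter F'"
    using F(2) a by blast
  moreover have "x \<sqinter> y \<in> F'" if xy: "x \<in> F'" "y \<in> F'" for x y
  proof -
    obtain f g where fg: "f \<in> F" "g \<in> F" "f \<sqinter> a \<sqsubseteq> x" "g \<sqinter> a \<sqsubseteq> y"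
      using xy by (auto simp: F'_def)
    have "(f \<sqinter> g) \<sqinter> a = (f \<sqinter> a) \<sqinter> (g \<sqinter> a)"
      using fg Fc a meet_swap [of f g a a] by (simp add: meet_idem)
    also have "\<dots> \<sqsubseteq> x \<sqinter> y"
      using fg xy Fc a by (intro meet_mono) (auto simp: F'_def meet_closed)
    finally show ?thesis
      using fg xy Fm by (auto simp: F'_def meet_closed)
  qed
  moreover have "y \<in> F'" if "x \<in> F'" "y \<in> carrier M" "x \<sqsubseteq> y" for x y
    using that le_trans meet_closed Fc a unfolding F'_def by blast
  moreover have "F' \<subseteq> carrier M" by (auto simp: F'_def)
  ultimately have "\<zero> \<in> F'"
    unfolding proper_filter_def by blast
  then obtain f where "f \<in> F" "f \<sqinter> a \<sqsubseteq> \<zero>" by (auto simp: F'_def)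
  then show ?thesis
    using that [of f] Fc a meet_zero meet_closed by (auto simp: le_def)
qed

definition two_valued_hom :: "('b \<Rightarrow> bool) \<Rightarrow> bool" where
  "two_valued_hom h \<longleftrightarrow> h \<one> \<and> \<not> h \<zero> \<and> (\<forall>a\<in>carrier M. h (\<sim> a) \<longleftrightarrow> \<not> h a)
    \<and> (\<forall>a\<in>carrier M. \<forall>b\<in>carrier M. h (a \<sqinter> b) \<longleftrightarrow> h a \<and> h b)
    \<and> (\<forall>a\<in>carrier M. \<forall>b\<in>carrier M. h (a \<squnion> b) \<longleftrightarrow> h a \<or> h b)"

lemma two_valued_homD:
  assumes "two_valued_hom h"
  shows "h \<one>" "\<not> h \<zero>" "a \<in> carrier M \<Longrightarrow> h (\<sim> a) \<longleftrightarrow> \<not> h a"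
    "a \<in> carrier M \<Longrightarrow> b \<in> carrier M \<Longrightarrow> h (a \<sqinter> b) \<longleftrightarrow> h a \<and> h b"
    "a \<in> carrier M \<Longrightarrow> b \<in> carrier M \<Longrightarrow> h (a \<squnion> b) \<longleftrightarrow> h a \<or> h b"
  using assms by (auto simp: two_valued_hom_def)

lemma two_valued_hom_le:
  assumes "two_valued_hom h" "a \<sqsubseteq> b" "a \<in> carrier M" "b \<in> carrier M"
  shows "h a \<Longrightarrow> h b"
  using assms two_valued_homD(4) by (metis le_def)

text \<open>The homomorphism is membership in a maximal filter containing \<open>c\<close>.\<close>

lemma two_valued_hom_exists:
  assumes c: "c \<in> carrier M" "c \<noteq> \<zero>"
  obtains h where "two_valued_hom h" "h c"
proof -
  obtain F where F: "proper_filter F" "c \<in> F"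
    and max: "\<And>F'. proper_filter F' \<Longrightarrow> F \<subseteq> F' \<Longrightarrow> F' = F"
    using maximal_filter_exists c by metis
  have Fc: "f \<in> carrier M" if "f \<in> F" for f
    using F(1) that by (auto simp: proper_filter_def)
  have Fm: "f \<sqinter> g \<in> F" if "f \<in> F" "g \<in> F" for f g
    using F(1) that by (auto simp: proper_filter_def)
  have Fu: "g \<in> F" if "f \<in> F" "f \<sqsubseteq> g" "g \<in> carrier M" for f g
    using F(1) that by (auto simp: proper_filter_def)
  have F0: "\<zero> \<notin> F"
    using F(1) by (auto simp: proper_filter_def)
  note mz = maximal_filter_meet_zero [OF F(1) max F(2)]
  have meet: "a \<sqinter> b \<in> F \<longleftrightarrow> a \<in> F \<and> b \<in> F" if "a \<in> carrier M" "b \<in> carrier M" for a b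
    using that Fm Fu [of "a \<sqinter> b" a] Fu [of "a \<sqinter> b" b]
      meet_le1 [of a b] meet_le1 [of b a] meet_comm [of a b]
    by auto
  \<comment> \<open>Primeness in contrapositive form: if neither \<open>a\<close> nor
    \<open>b\<close> is in \<open>F\<close>, a single member of \<open>F\<close> is disjoint from
    both.\<close>
  have join_zero': "\<exists>f\<in>F. f \<sqinter> (a \<squnion> b) = \<zero>"
    if ab: "a \<in> carrier M" "b \<in> carrier M" "a \<notin> F" "b \<notin> F" for a b
  proof -
    obtain f g where fg: "f \<in> F" "f \<sqinter> a = \<zero>" "g \<in> F" "g \<sqinter> b = \<zero>"
      using mz ab by metis
    have "(f \<sqinter> g) \<sqinter> a = g \<sqinter> (f \<sqinter> a)" "(f \<sqinter> g) \<sqinter> b = f \<sqinter> (g \<sqinter> b)"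
      using fg(1,3) Fc ab by (metis meet_assoc meet_comm)+
    then have "(f \<sqinter> g) \<sqinter> (a \<squnion> b) = \<zero>"
      using fg Fc ab by (simp add: meet_join_distrib meet_closed meet_zero join_zero zero_closed)
    then show ?thesis using fg Fm by blast
  qed
  have join: "a \<squnion> b \<in> F \<longleftrightarrow> a \<in> F \<or> b \<in> F" if "a \<in> carrier M" "b \<in> carrier M" for a b
  proof
    show "a \<in> F \<or> b \<in> F" if "a \<squnion> b \<in> F"
      using join_zero' \<open>a \<in> carrier M\<close> \<open>b \<in> carrier M\<close> that Fm F0 by metis
    have "a \<sqsubseteq> a \<squnion> b" "b \<sqsubseteq> a \<squnion> b"
      using that le_join1 [of a b] le_join1 [of b a] by (simp_all add: join_comm [of b a])
    then show "a \<squnion> b \<in> F" if "a \<in> F \<or> b \<in> F"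
      using that Fu join_closed \<open>a \<in> carrier M\<close> \<open>b \<in> carrier M\<close> by blast
  qed
  have one: "\<one> \<in> F"
    using F(2) Fu c meet_one one_closed by (auto simp: le_def)
  have compl: "\<sim> a \<in> F \<longleftrightarrow> a \<notin> F" if "a \<in> carrier M" for a
    using that join [of a "\<sim> a"] meet [of a "\<sim> a"] one F0
    by (auto simp: compl_closed join_compl meet_compl)
  show ?thesis
    using that [of "\<lambda>x. x \<in> F"] meet join one compl F0 F(2)
    by (auto simp: two_valued_hom_def)
qed

lemma eq_zeroI: "c \<in> carrier M \<Longrightarrow> (\<And>h. two_valued_hom h \<Longrightarrow> \<not> h c) \<Longrightarrow> c = \<zero>"
  using two_valued_hom_exists by metis

text \<open>Applied to \<open>a \<sqinter> \<sim> b\<close>, the separation property reduces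
  inequalities to truth-value reasoning.\<close>

lemma leI_two_valued:
  assumes "a \<in> carrier M" "b \<in> carrier M" "\<And>h. two_valued_hom h \<Longrightarrow> h a \<Longrightarrow> h b"
  shows "a \<sqsubseteq> b"
proof -
  have "a \<sqinter> \<sim> b = \<zero>"
    using assms by (intro eq_zeroI) (auto simp: two_valued_homD meet_closed compl_closed)
  then have "a \<sqinter> b = a"
    using assms by (metis compl_closed join_compl join_zero meet_closed meet_join_distrib meet_one)
  then show ?thesis by (simp add: le_def)
qed

lemma eqI_two_valued:
  assumes "a \<in> carrier M" "b \<in> carrier M" "\<And>h. two_valued_hom h \<Longrightarrow> h a \<longleftrightarrow> h b"
  shows "a = b"
  using assms by (intro le_antisym leI_two_valued) auto

end

section \<open>Derived laws of interior operators and quantifiers\<close>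

context interior_operator
begin

lemma interior_mono:
  assumes "a \<in> carrier M" "b \<in> carrier M" "a \<sqsubseteq> b"
  shows "\<^bold>I a \<sqsubseteq> \<^bold>I b"
  using assms interior_meet [of a b] by (simp add: le_def)

lemma interior_imp:
  assumes "a \<in> carrier M" "b \<in> carrier M"
  shows "\<^bold>I (\<sim> (a \<sqinter> \<sim> b)) \<sqinter> \<^bold>I a \<sqsubseteq> \<^bold>I b"
proof -
  have "\<sim> (a \<sqinter> \<sim> b) \<sqinter> a \<sqsubseteq> b"
    using assms by (intro leI_two_valued) (auto simp: two_valued_homD meet_closed compl_closed)
  then have "\<^bold>I (\<sim> (a \<sqinter> \<sim> b) \<sqinter> a) \<sqsubseteq> \<^bold>I b"
    using assms by (intro interior_mono) (auto simp: meet_closed compl_closed)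
  then show ?thesis
    using assms by (simp add: interior_meet meet_closed compl_closed)
qed

end

context universal_quantifier
begin

lemma univ_univ: "a \<in> carrier M \<Longrightarrow> \<^bold>\<forall> (\<^bold>\<forall> a) = \<^bold>\<forall> a"
proof -
  assume a: "a \<in> carrier M"
  have "\<^bold>\<forall> \<zero> = \<zero>"
    using univ_le [of \<zero>] meet_zero univ_closed zero_closed by (simp add: le_def)
  then show ?thesis
    using univ_join [of \<zero> a] a
    by (simp add: join_comm [of \<zero>] zero_closed univ_closed join_zero)
qed

text \<open>\<open>univ_join\<close> splits the quantifier over an instance of excluded middle, one
  side of which is already quantified.\<close>

lemma univ_compl_univ:
  assumes "a \<in> carrier M"
  shows "\<^bold>\<forall> (\<sim> (\<^bold>\<forall> a)) = \<sim> (\<^bold>\<forall> a)"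
proof (rule le_antisym)
  have "\<sim> (\<^bold>\<forall> a) \<squnion> \<^bold>\<forall> a = \<one>"
    using assms by (metis compl_closed join_comm join_compl univ_closed)
  then have *: "\<^bold>\<forall> (\<sim> (\<^bold>\<forall> a)) \<squnion> \<^bold>\<forall> a = \<one>"
    using univ_join [of "\<sim> (\<^bold>\<forall> a)" a] assms by (simp add: univ_one univ_closed compl_closed)
  show "\<sim> (\<^bold>\<forall> a) \<sqsubseteq> \<^bold>\<forall> (\<sim> (\<^bold>\<forall> a))"
  proof (rule leI_two_valued)
    fix h assume h: "two_valued_hom h" "h (\<sim> (\<^bold>\<forall> a))"
    have "h (\<^bold>\<forall> (\<sim> (\<^bold>\<forall> a)) \<squnion> \<^bold>\<forall> a)" using * h by (simp add: two_valued_homD)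
    then show "h (\<^bold>\<forall> (\<sim> (\<^bold>\<forall> a)))"
      using h assms by (simp add: two_valued_homD univ_closed compl_closed)
  qed (use assms in \<open>simp_all add: univ_closed compl_closed\<close>)
qed (use assms in \<open>simp_all add: univ_closed compl_closed univ_le\<close>)

text \<open>Distribution over implication is extracted from \<open>univ_join\<close>: the Boolean
  fact is written as a join equal to \<one>, in which all members but \<open>b\<close> are fixed by
  the quantifier, by \<open>univ_compl_univ\<close>.\<close>

lemma univ_imp:
  assumes "a \<in> carrier M" "b \<in> carrier M"
  shows "\<^bold>\<forall> (\<sim> (a \<sqinter> \<sim> b)) \<sqinter> \<^bold>\<forall> a \<sqsubseteq> \<^bold>\<forall> b"
proof -
  define x where "x = \<sim> (a \<sqinter> \<sim> b)"
  have x: "x \<in> carrier M" using assms by (simp add: x_def compl_closed meet_closed)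
  note cl = assms x univ_closed compl_closed meet_closed join_closed one_closed
  have "(b \<squnion> \<sim> (\<^bold>\<forall> x)) \<squnion> \<sim> (\<^bold>\<forall> a) = \<one>"
  proof (rule eqI_two_valued)
    fix h assume h: "two_valued_hom h"
    have "h (\<^bold>\<forall> x) \<Longrightarrow> h x" "h (\<^bold>\<forall> a) \<Longrightarrow> h a"
      using two_valued_hom_le [OF h univ_le] cl by blast+
    then show "h ((b \<squnion> \<sim> (\<^bold>\<forall> x)) \<squnion> \<sim> (\<^bold>\<forall> a)) \<longleftrightarrow> h \<one>"
      using h by (auto simp: two_valued_homD cl) (simp add: x_def two_valued_homD cl(1-2,4-))
  qed (simp_all add: cl)
  then have *: "(\<^bold>\<forall> b \<squnion> \<sim> (\<^bold>\<forall> x)) \<squnion> \<sim> (\<^bold>\<forall> a) = \<one>"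
    using univ_join [of "b \<squnion> \<sim> (\<^bold>\<forall> x)" "\<sim> (\<^bold>\<forall> a)"] univ_join [of b "\<sim> (\<^bold>\<forall> x)"]
    by (simp add: univ_compl_univ univ_one cl)
  show ?thesis
    unfolding x_def [symmetric]
  proof (rule leI_two_valued)
    fix h assume h: "two_valued_hom h" "h (\<^bold>\<forall> x \<sqinter> \<^bold>\<forall> a)"
    have "h ((\<^bold>\<forall> b \<squnion> \<sim> (\<^bold>\<forall> x)) \<squnion> \<sim> (\<^bold>\<forall> a))"
      using * h by (simp add: two_valued_homD)
    then show "h (\<^bold>\<forall> b)"
      using h by (simp add: two_valued_homD cl)
  qed (simp_all add: cl)
qed

text \<open>The value of \<open>exis\<close> is the complement of a quantified element, hence fixed
  by the quantifier, so it suffices that \<open>a\<close> lies below it.\<close>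

lemma le_univ_exis:
  assumes "a \<in> carrier M"
  shows "a \<sqsubseteq> \<^bold>\<forall> (\<^bold>\<exists> a)"
proof -
  have "a \<sqsubseteq> \<sim> (\<^bold>\<forall> (\<sim> a))"
  proof (rule leI_two_valued)
    fix h assume h: "two_valued_hom h" "h a"
    have "h (\<^bold>\<forall> (\<sim> a)) \<Longrightarrow> h (\<sim> a)"
      using two_valued_hom_le [OF h(1) univ_le] assms compl_closed univ_closed by blast
    then show "h (\<sim> (\<^bold>\<forall> (\<sim> a)))"
      using h assms by (auto simp: two_valued_homD univ_closed compl_closed)
  qed (use assms in \<open>simp_all add: univ_closed compl_closed\<close>)
  then show ?thesis
    using assms by (simp add: exis_def univ_compl_univ compl_closed)
qed

end

section \<open>Valuations and soundness of the axioms\<close>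

locale GMA_valuation = GMA M + valuation M v for M (structure) and v
begin

lemma v_Imp_eq_one:
  assumes "v \<phi> \<sqsubseteq> v \<psi>"
  shows "v (Imp \<phi> \<psi>) = \<one>"
proof (rule eqI_two_valued)
  fix h assume h: "two_valued_hom h"
  then show "h (v (Imp \<phi> \<psi>)) \<longleftrightarrow> h \<one>"
    using two_valued_hom_le [OF h assms v_range v_range]
    by (auto simp: v_Neg v_Conj two_valued_homD v_range meet_closed compl_closed)
qed (simp_all add: v_range one_closed)

text \<open>A two-valued homomorphism turns a valuation into a truth assignment in which formulas
  starting with \<open>Box\<close> or \<open>Know\<close> behave as atoms; hence tautologies get
  value \<one>.\<close>

lemma two_valued_truth:
  assumes "two_valued_hom h"
  shows "truth (\<lambda>\<psi>. h (v \<psi>)) \<phi> \<longleftrightarrow> h (v \<phi>)"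
  by (induction \<phi>)
    (use assms in \<open>auto simp: v_verum v_falsum v_Neg v_Conj two_valued_homD v_range\<close>)

lemma v_Imp_Imp_eq_one:
  assumes "v \<phi> \<sqinter> v \<psi> \<sqsubseteq> v \<chi>"
  shows "v (Imp \<phi> (Imp \<psi> \<chi>)) = \<one>"
proof (rule eqI_two_valued)
  fix h assume h: "two_valued_hom h"
  then show "h (v (Imp \<phi> (Imp \<psi> \<chi>))) \<longleftrightarrow> h \<one>"
    using two_valued_hom_le [OF h assms meet_closed [OF v_range v_range] v_range]
    by (auto simp: v_Neg v_Conj two_valued_homD v_range meet_closed compl_closed)
qed (simp_all add: v_range one_closed)

lemma v_Dia: "v (Dia \<phi>) = \<^bold>C (v \<phi>)"
  by (simp add: v_Neg v_Box closure_def)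

lemma v_Poss: "v (Poss \<phi>) = \<^bold>\<exists> (v \<phi>)"
  by (simp add: v_Neg v_Know exis_def)

lemma MP_star_sound: "MP_star \<phi> \<Longrightarrow> v \<phi> = \<one>"
proof (induction rule: MP_star.induct)
  case (Taut \<phi>)
  show ?case
  proof (rule eqI_two_valued)
    fix h assume "two_valued_hom h"
    then show "h (v \<phi>) \<longleftrightarrow> h \<one>"
      using Taut two_valued_truth by (auto simp: tautology_def two_valued_homD)
  qed (simp_all add: v_range one_closed)
next
  case (Persist A)
  let ?a = "v (Atom A)"
  have "?a \<sqsubseteq> \<^bold>I ?a" and C: "\<^bold>C ?a \<sqsubseteq> ?a"
    using v_Atom [of A] by (auto simp: stable_def)
  then have "v (Imp (Atom A) (Box (Atom A))) = \<one>"
    by (intro v_Imp_eq_one) (simp add: v_Box)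
  \<comment> \<open>The negative half of persistence: closedness of the value of the atom is
    openness of its complement.\<close>
  moreover have "\<sim> ?a \<sqsubseteq> \<^bold>I (\<sim> ?a)"
  proof (rule leI_two_valued)
    fix h assume h: "two_valued_hom h" "h (\<sim> ?a)"
    have "h (\<^bold>C ?a) \<Longrightarrow> h ?a"
      using two_valued_hom_le [OF h(1) C _ v_range] v_range
      by (simp add: closure_def interior_closed compl_closed)
    then show "h (\<^bold>I (\<sim> ?a))"
      using h by (auto simp: closure_def two_valued_homD interior_closed compl_closed v_range)
  qed (simp_all add: interior_closed compl_closed v_range)
  then have "v (Imp (Neg (Atom A)) (Box (Neg (Atom A)))) = \<one>"
    by (intro v_Imp_eq_one) (simp add: v_Box v_Neg)
  ultimately show ?case
    by (subst v_Conj) (simp only: meet_one one_closed)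
next
  case (Box_K \<phi> \<psi>)
  show ?case
    by (rule v_Imp_Imp_eq_one) (simp add: v_Box v_Neg v_Conj interior_imp v_range)
next
  case (Box_T \<phi>)
  show ?case by (rule v_Imp_eq_one) (simp add: v_Box interior_le v_range)
next
  case (Box_4 \<phi>)
  show ?case
    by (rule v_Imp_eq_one) (simp add: v_Box interior_idem interior_closed v_range le_refl)
next
  case (Know_K \<phi> \<psi>)
  show ?case
    by (rule v_Imp_Imp_eq_one) (simp add: v_Know v_Neg v_Conj univ_imp v_range)
next
  case (Know_T \<phi>)
  show ?case by (rule v_Imp_eq_one) (simp add: v_Know univ_le v_range)
next
  case (Know_4 \<phi>)
  show ?case
    by (rule v_Imp_eq_one) (simp add: v_Know univ_univ univ_closed v_range le_refl)
next
  case (Know_B \<phi>)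
  show ?case
    by (rule v_Imp_eq_one) (simp only: v_Know v_Poss le_univ_exis v_range)
next
  case (Cross \<phi>)
  show ?case
    by (rule v_Imp_eq_one) (simp add: v_Know v_Box univ_interior_le v_range)
next
  case (Directed \<phi>)
  have "\<^bold>C (\<^bold>I (v \<phi>)) \<sqsubseteq> \<^bold>I (\<^bold>C (v \<phi>))"
    unfolding closure_interior [OF v_range]
    by (intro le_refl) (simp add: closure_def interior_closed compl_closed v_range)
  then show ?case
    by (intro v_Imp_eq_one) (simp only: v_Dia v_Box)
next
  case (Union \<phi> \<psi> \<chi>)
  show ?case
    by (rule v_Imp_eq_one) (simp only: v_Dia v_Poss v_Know v_Conj union_le v_range)
next
  case (MP \<phi> \<psi>)
  show ?case
  proof (rule eqI_two_valued)
    fix h assume h: "two_valued_hom h"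
    have "h (v (Imp \<phi> \<psi>))" "h (v \<phi>)" using MP h by (auto simp: two_valued_homD)
    then show "h (v \<psi>) \<longleftrightarrow> h \<one>"
      using h by (auto simp: v_Neg v_Conj two_valued_homD v_range meet_closed compl_closed)
  qed (simp_all add: v_range one_closed)
next
  case (Know_nec \<phi>)
  then show ?case by (simp add: v_Know univ_one)
next
  case (Box_nec \<phi>)
  then show ?case by (simp add: v_Box interior_one)
qed

end

section \<open>The Lindenbaum algebra\<close>

lemma MP_star_taut1: "MP_star \<phi> \<Longrightarrow> (\<And>g. truth g \<phi> \<Longrightarrow> truth g \<psi>) \<Longrightarrow> MP_star \<psi>"
  by (rule MP [OF Taut]) (auto simp: tautology_def)

lemma MP_star_taut2:
  "MP_star \<phi>\<^sub>1 \<Longrightarrow> MP_star \<phi>\<^sub>2 \<Longrightarrow> (\<And>g. truth g \<phi>\<^sub>1 \<Longrightarrow> truth g \<phi>\<^sub>2 \<Longrightarrow> truth g \<psi>) \<Longrightarrow> MP_star \<psi>"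
  by (rule MP [OF MP_star_taut1 [of \<phi>\<^sub>1 "Imp \<phi>\<^sub>2 \<psi>"]]) auto

lemma MP_star_taut: "(\<And>g. truth g \<psi>) \<Longrightarrow> MP_star \<psi>"
  by (rule Taut) (simp add: tautology_def)

lemma Box_mono: "MP_star (Imp \<phi> \<psi>) \<Longrightarrow> MP_star (Imp (Box \<phi>) (Box \<psi>))"
  by (rule MP [OF Box_K Box_nec])

lemma Know_mono: "MP_star (Imp \<phi> \<psi>) \<Longrightarrow> MP_star (Imp (Know \<phi>) (Know \<psi>))"
  by (rule MP [OF Know_K Know_nec])

definition lind_eq :: "'a::atomic_formulas fm \<Rightarrow> 'a fm \<Rightarrow> bool" where
  "lind_eq \<phi> \<psi> \<longleftrightarrow> MP_star (Imp \<phi> \<psi>) \<and> MP_star (Imp \<psi> \<phi>)"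

lemma MP_star_Imp_trans: "MP_star (Imp \<phi> \<psi>) \<Longrightarrow> MP_star (Imp \<psi> \<chi>) \<Longrightarrow> MP_star (Imp \<phi> \<chi>)"
  by (erule (1) MP_star_taut2) auto

lemma MP_star_Imp_refl: "MP_star (Imp \<phi> \<phi>)"
  by (rule MP_star_taut) auto

quotient_type (overloaded) 'a lind = "'a::atomic_formulas fm" / lind_eq
  by (rule equivpI)
    (auto simp: reflp_def symp_def transp_def lind_eq_def intro: MP_star_Imp_refl MP_star_Imp_trans)

lemma Conj_mono:
  "MP_star (Imp \<phi> \<phi>') \<Longrightarrow> MP_star (Imp \<psi> \<psi>') \<Longrightarrow> MP_star (Imp (Conj \<phi> \<psi>) (Conj \<phi>' \<psi>'))"
  by (erule (1) MP_star_taut2) auto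

lemma Neg_antimono: "MP_star (Imp \<phi> \<psi>) \<Longrightarrow> MP_star (Imp (Neg \<psi>) (Neg \<phi>))"
  by (erule MP_star_taut1) auto

section \<open>The Boolean algebra of formulas modulo provable equivalence\<close>

instantiation lind :: (atomic_formulas) boolean_algebra
begin

lift_definition inf_lind :: "'a lind \<Rightarrow> 'a lind \<Rightarrow> 'a lind" is Conj
  by (auto simp: lind_eq_def intro: Conj_mono)

lift_definition uminus_lind :: "'a lind \<Rightarrow> 'a lind" is Neg
  by (auto simp: lind_eq_def intro: Neg_antimono)

lift_definition sup_lind :: "'a lind \<Rightarrow> 'a lind \<Rightarrow> 'a lind" is Disj
  by (auto simp: lind_eq_def intro: Conj_mono Neg_antimono)

lift_definition minus_lind :: "'a lind \<Rightarrow> 'a lind \<Rightarrow> 'a lind" is "\<lambda>\<phi> \<psi>. Conj \<phi> (Neg \<psi>)"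
  by (auto simp: lind_eq_def intro: Conj_mono Neg_antimono)

lift_definition top_lind :: "'a lind" is "Atom verum" .

lift_definition bot_lind :: "'a lind" is "Atom falsum" .

lift_definition less_eq_lind :: "'a lind \<Rightarrow> 'a lind \<Rightarrow> bool" is "\<lambda>\<phi> \<psi>. MP_star (Imp \<phi> \<psi>)"
  unfolding lind_eq_def by (meson MP_star_Imp_trans)

definition less_lind :: "'a lind \<Rightarrow> 'a lind \<Rightarrow> bool" where
  "less_lind x y \<longleftrightarrow> x \<le> y \<and> \<not> y \<le> x"

instance
proof
  fix x y z :: "'a lind"
  \<comment> \<open>Evaluating \<open>truth\<close> at \<open>Atom falsum\<close> first tests
    equality with \<open>verum\<close>.\<close>
  note [simp] = verum_neq_falsum verum_neq_falsum [symmetric]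
  show "x < y \<longleftrightarrow> x \<le> y \<and> \<not> y \<le> x"
    by (rule less_lind_def)
  show "x \<le> x"
    by transfer (rule MP_star_Imp_refl)
  show "x \<le> y \<Longrightarrow> y \<le> z \<Longrightarrow> x \<le> z"
    by transfer (rule MP_star_Imp_trans)
  show "x \<le> y \<Longrightarrow> y \<le> x \<Longrightarrow> x = y"
    by transfer (simp add: lind_eq_def)
  show "inf x y \<le> x" "inf x y \<le> y"
    by (transfer; rule MP_star_taut; auto)+
  show "x \<le> y \<Longrightarrow> x \<le> z \<Longrightarrow> x \<le> inf y z"
    by transfer (erule (1) MP_star_taut2; auto)
  show "x \<le> sup x y" "y \<le> sup x y"
    by (transfer; rule MP_star_taut; auto)+
  show "y \<le> x \<Longrightarrow> z \<le> x \<Longrightarrow> sup y z \<le> x"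
    by transfer (erule (1) MP_star_taut2; auto)
  show "bot \<le> x"
    by transfer (rule MP_star_taut; auto)
  show "x \<le> top"
    by transfer (rule MP_star_taut; auto)
  show "sup x (inf y z) = inf (sup x y) (sup x z)"
    by transfer (auto simp: lind_eq_def intro!: MP_star_taut)
  show "inf x (- x) = bot"
    by transfer (auto simp: lind_eq_def intro!: MP_star_taut)
  show "sup x (- x) = top"
    by transfer (auto simp: lind_eq_def intro!: MP_star_taut)
  show "x - y = inf x (- y)"
    by transfer (simp add: lind_eq_def MP_star_Imp_refl)
qed

end

lift_definition box :: "'a::atomic_formulas lind \<Rightarrow> 'a lind" is Box
  by (auto simp: lind_eq_def intro: Box_mono)

lift_definition know :: "'a::atomic_formulas lind \<Rightarrow> 'a lind" is Know
  by (auto simp: lind_eq_def intro: Know_mono)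

text \<open>The bridge back to derivability: \<open>Atom verum\<close> is a tautology, so
  equivalence with it amounts to being a theorem.\<close>

lemma abs_lind_eq_top: "abs_lind \<phi> = top \<longleftrightarrow> MP_star \<phi>"
proof -
  have "abs_lind \<phi> = top \<longleftrightarrow> lind_eq \<phi> (Atom verum)"
    by (simp add: top_lind_def lind.abs_eq_iff)
  also have "\<dots> \<longleftrightarrow> MP_star \<phi>"
  proof
    show "MP_star \<phi>" if "lind_eq \<phi> (Atom verum)"
      using that unfolding lind_eq_def by (auto elim: MP_star_taut1)
    show "lind_eq \<phi> (Atom verum)" if "MP_star \<phi>"
      using that unfolding lind_eq_def by (auto elim: MP_star_taut1)
  qed
  finally show ?thesis .
qed

text \<open>Stated for an arbitrary \<open>J\<close> to serve both modalities. The converse half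
  applies \<open>J\<close> to the tautology
  \<open>Imp \<phi> (Imp \<psi> (Conj \<phi> \<psi>))\<close>.\<close>

lemma normal_modality_Conj:
  assumes mono: "\<And>\<phi> \<psi>. MP_star (Imp \<phi> \<psi>) \<Longrightarrow> MP_star (Imp (J \<phi>) (J \<psi>))"
    and K: "\<And>\<phi> \<psi>. MP_star (Imp (J (Imp \<phi> \<psi>)) (Imp (J \<phi>) (J \<psi>)))"
  shows "lind_eq (J (Conj \<phi> \<psi>)) (Conj (J \<phi>) (J \<psi>))"
proof -
  have "MP_star (Imp (J (Conj \<phi> \<psi>)) (J \<phi>))" "MP_star (Imp (J (Conj \<phi> \<psi>)) (J \<psi>))"
    by (rule mono, rule MP_star_taut, auto)+
  then have "MP_star (Imp (J (Conj \<phi> \<psi>)) (Conj (J \<phi>) (J \<psi>)))"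
    by (rule MP_star_taut2) auto
  moreover have "MP_star (Imp (J \<phi>) (J (Imp \<psi> (Conj \<phi> \<psi>))))"
    by (rule mono, rule MP_star_taut, auto)
  from this K [of \<psi> "Conj \<phi> \<psi>"] have "MP_star (Imp (Conj (J \<phi>) (J \<psi>)) (J (Conj \<phi> \<psi>)))"
    by (rule MP_star_taut2) auto
  ultimately show ?thesis by (simp add: lind_eq_def)
qed

text \<open>Most goals transfer to axioms; preservation of meets needs
  \<open>normal_modality_Conj\<close>, and preservation of top needs necessitation.\<close>

interpretation lind: weak_GMA "box :: 'a::atomic_formulas lind \<Rightarrow> 'a lind" know
proof
  fix a b c :: "'a lind"
  have verum: "MP_star (Atom verum :: 'a fm)"
    by (rule MP_star_taut) simp
  show "box (inf a b) = inf (box a) (box b)"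
    by transfer (rule normal_modality_Conj [OF Box_mono Box_K])
  show "know (inf a b) = inf (know a) (know b)"
    by transfer (rule normal_modality_Conj [OF Know_mono Know_K])
  show "box a \<le> a" "know a \<le> a"
    by (transfer, rule Box_T Know_T)+
  show "box (box a) = box a" "know (know a) = know a"
    by (transfer, simp add: lind_eq_def Box_4 Box_T Know_4 Know_T)+
  show "a \<le> know (- know (- a))"
    by transfer (rule Know_B)
  show "box top = (top :: 'a lind)"
    using verum by transfer
      (auto simp: lind_eq_def intro: MP_star_taut1 [OF Box_nec] MP_star_taut)
  show "know top = (top :: 'a lind)"
    using verum by transfer
      (auto simp: lind_eq_def intro: MP_star_taut1 [OF Know_nec] MP_star_taut)
  show "know (box a) \<le> box (know a)"
    by transfer (rule Cross)
  show "- box (- box a) \<le> box (- box (- a))"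
    by transfer (rule Directed)
  show "inf (- box (- inf (know a) b)) (- know (- (- box (- inf (know a) c))))
      \<le> - box (- inf (inf (know (- box (- a))) (- box (- b))) (- know (- (- box (- c)))))"
    by transfer (rule Union)
qed

text \<open>\<open>Persist\<close> makes both the atom and its negation open; openness of the
  negation is closedness of the atom.\<close>

lemma abs_lind_Atom: "abs_lind (Atom A) \<in> lind.S"
proof -
  have 1: "MP_star (Imp (Atom A) (Box (Atom A)))"
    by (rule MP_star_taut1 [OF Persist [of A]]) auto
  have 2: "MP_star (Imp (Neg (Atom A)) (Box (Neg (Atom A))))"
    by (rule MP_star_taut1 [OF Persist [of A]]) auto
  have "box (abs_lind (Atom A)) = abs_lind (Atom A)"
    using 1 by (simp add: box.abs_eq lind.abs_eq_iff lind_eq_def Box_T)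
  moreover have "box (- abs_lind (Atom A)) = - abs_lind (Atom A)"
    using 2 by (simp add: box.abs_eq uminus_lind.abs_eq lind.abs_eq_iff lind_eq_def Box_T)
  ultimately show ?thesis
    by (simp add: lind.S_def lind.C_def)
qed

text \<open>Atoms are stable and \<open>D\<close> is closed under every connective, so the normal
  forms exhaust the Lindenbaum algebra.\<close>

lemma abs_lind_D: "abs_lind \<phi> \<in> lind.D"
proof (induction \<phi>)
  case (Atom A)
  show ?case by (rule lind.D_S [OF abs_lind_Atom])
qed (simp_all flip: inf_lind.abs_eq uminus_lind.abs_eq box.abs_eq know.abs_eq
      add: lind.D_inf lind.D_compl lind.D_I lind.D_K_closed)

lemma lind_CI_eq_IC: "lind.C (box a) = box (lind.C a)"
  by (rule lind.CI_eq_IC) (induction a rule: lind.abs_induct, rule abs_lind_D)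

section \<open>Copies of the Lindenbaum algebra in infinite types\<close>

instance fm :: (countable) countable
  by countable_datatype

lemma ex_inj_lind:
  assumes "infinite (UNIV :: 'b set)"
  shows "\<exists>f :: 'a::atomic_formulas lind \<Rightarrow> 'b. inj f"
proof -
  obtain g :: "nat \<Rightarrow> 'b" where "inj g"
    using infinite_countable_subset [OF assms] by blast
  moreover have "inj (rep_lind :: 'a lind \<Rightarrow> 'a fm)"
    by (metis Quotient3_abs_rep Quotient3_lind injI)
  moreover have "inj (to_nat :: 'a fm \<Rightarrow> nat)"
    by simp
  ultimately have "inj (g \<circ> (to_nat \<circ> rep_lind) :: 'a lind \<Rightarrow> 'b)"
    by (intro inj_compose)
  then show ?thesis by blast
qed

text \<open>The structure is transported along \<open>f\<close>, with \<open>inv f\<close>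
  recovering the class behind an element of the range when \<open>f\<close> is injective.\<close>

definition lind_alg :: "('a::atomic_formulas lind \<Rightarrow> 'b) \<Rightarrow> 'b monadic_alg" where
  "lind_alg f = \<lparr>carrier = range f, bzero = f bot, bone = f top,
     compl = (\<lambda>x. f (- inv f x)), meet = (\<lambda>x y. f (inf (inv f x) (inv f y))),
     join = (\<lambda>x y. f (sup (inv f x) (inv f y))), interior = (\<lambda>x. f (box (inv f x))),
     univ = (\<lambda>x. f (know (inv f x)))\<rparr>"

context
  fixes f :: "'a::atomic_formulas lind \<Rightarrow> 'b"
  assumes f: "inj f"
begin

lemma lind_alg_simps:
  "carrier (lind_alg f) = range f" "bzero (lind_alg f) = f bot" "bone (lind_alg f) = f top"
  "compl (lind_alg f) (f a) = f (- a)" "meet (lind_alg f) (f a) (f b) = f (inf a b)"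
  "join (lind_alg f) (f a) (f b) = f (sup a b)" "interior (lind_alg f) (f a) = f (box a)"
  "univ (lind_alg f) (f a) = f (know a)" "closure (lind_alg f) (f a) = f (lind.C a)"
  "exis (lind_alg f) (f a) = f (lind.L a)" "le (lind_alg f) (f a) (f b) \<longleftrightarrow> a \<le> b"
  "f a = f b \<longleftrightarrow> a = b"
  using f
  by (simp_all add: lind_alg_def closure_def exis_def le_def lind.C_def lind.L_def inj_eq
      flip: inf.absorb_iff1 inf.order_iff)

lemma GMA_lind_alg: "GMA (lind_alg f)"
  by standard
    (auto simp: lind_alg_simps lind.I_inf lind.I_le lind.I_idem lind.I_top lind.K_le lind.K_top
      lind.K_sup_K lind.cross lind_CI_eq_IC lind.union_C_L,
      (rule inf_assoc sup_assoc inf_commute sup_commute inf_sup_distrib1 sup_inf_distrib1)+)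

lemma valuation_lind_alg: "valuation (lind_alg f) (\<lambda>\<phi>. f (abs_lind \<phi>))"
proof
  fix A
  show "f (abs_lind (Atom A)) \<in> stable (lind_alg f)"
    using abs_lind_Atom [of A] by (auto simp: stable_def lind_alg_simps lind.S_def)
qed (simp_all add: lind_alg_simps inf_lind.abs_eq sup_lind.abs_eq uminus_lind.abs_eq box.abs_eq
    know.abs_eq top_lind_def bot_lind_def)

end

theorem mainTheorem19:
  fixes \<phi> :: "'a::atomic_formulas fm"
  assumes "infinite (UNIV :: 'b set)"
  shows "MP_star \<phi> \<longleftrightarrow> GMA_valid TYPE('b) \<phi>"
proof
  assume "MP_star \<phi>"
  then show "GMA_valid TYPE('b) \<phi>"
    unfolding GMA_valid_def
    by (auto intro: GMA_valuation.MP_star_sound GMA_valuation.intro)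
next
  assume valid: "GMA_valid TYPE('b) \<phi>"
  obtain f :: "'a lind \<Rightarrow> 'b" where f: "inj f"
    using ex_inj_lind [OF assms] by blast
  \<comment> \<open>Validity is applied to the copied Lindenbaum algebra, with the valuation that
    sends each formula to the copy of its class.\<close>
  have "f (abs_lind \<phi>) = f top"
    using valid GMA_lind_alg [OF f] valuation_lind_alg [OF f] lind_alg_simps(3) [OF f]
    unfolding GMA_valid_def by metis
  then show "MP_star \<phi>"
    using f by (simp add: inj_eq abs_lind_eq_top)
qed

end
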